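(* Let $\mathcal{U}$ be a stable ordered-union ultrafilter on $\mathrm{FIN}$. Then $\mathcal{U}$ is rapid.
   Context: $\mathrm{FIN}$ is the set of all finite nonempty subsets of $\omega$. An infinite block sequence is a map $X : \omega \to \mathrm{FIN}$ with $\max(X(i)) < \min(X(i+1))$ for all $i$; $\mathrm{FIN}^{[\infty]}$ is the set of all infinite block sequences. For $X \in \mathrm{FIN}^{[\infty]}$, $[X] = \{ \bigcup_{i \in F} X(i) : F \subseteq \omega \text{ finite nonempty}\} \subseteq \mathrm{FIN}$. Write $X \leq Y$ iff $X(i) \in [Y]$ for all $i$. For $n\in\omega$, $X/n = (X(i))_{i \geq i_0}$ (re-indexed from $0$), where $i_0$ is least with $\min(X(i_0)) > n$. Write $X \leq^* Y$ iff there is $n \in \omega$ with $X/n \leq Y$. A filter base for an ultrafilter $\mathcal{U}$ is a set $\mathcal{B} \subseteq \mathcal{U}$ such that every $U \in \mathcal{U}$ contains some $B \in \mathcal{B}$. An ultrafilter $\mathcal{U}$ on $\mathrm{FIN}$ is ordered-union if it has a filter base all of whose members have the form $[X]$ for some $X \in \mathrm{FIN}^{[\infty]}$. It is stable ordered-union if it is ordered-union and for every sequence $(X_i)_{i \in \omega}$ in $\mathrm{FIN}^{[\infty]}$ with $[X_i] \in \mathcal{U}$ and $X_{i+1} \leq^* X_i$ for all $i$, there is $X\in\mathrm{FIN}^{[\infty]}$ with $[X] \in \mathcal{U}$ and $X \leq^* X_i$ for all $i$. A nonprincipal ultrafilter $\mathcal{V}$ on a countable set $I$ is rapid if one of the following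 equivalent conditions holds: (1) for every sequence $(P_n)_{n \in \omega}$ of finite subsets of $I$ there is $X \in \mathcal{V}$ with $|X \cap P_n| \leq n$ for each $n \in \omega$; (2) there is $h : \omega \to \omega$ such that for every sequence $(P_n)_{n \in \omega}$ of finite subsets of $I$ there is $X \in \mathcal{V}$ with $|X \cap P_n| \leq h(n)$ for each $n \in \omega$. (The equivalence is due to Miller.) *)

theory Defs
  imports "HOL-Library.Countable_Set"
begin

text \<open>Filters on a set \<open>I\<close> are represented as families of subsets of \<open>I\<close>, so that a base
  of the form \<open>[X]\<close> is literally a family of members of the ultrafilter.\<close>

definition ultrafilter_on :: "'a set \<Rightarrow> 'a set set \<Rightarrow> bool" where
  "ultrafilter_on I U \<longleftrightarrow>
     U \<subseteq> Pow I \<and> I \<in> U \<and> {} \<notin> U \<and>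
     (\<forall>A\<in>U. \<forall>B\<in>U. A \<inter> B \<in> U) \<and>
     (\<forall>A\<in>U. \<forall>B. A \<subseteq> B \<and> B \<subseteq> I \<longrightarrow> B \<in> U) \<and>
     (\<forall>A. A \<subseteq> I \<longrightarrow> A \<in> U \<or> I - A \<in> U)"

definition principal_on :: "'a set \<Rightarrow> 'a set set \<Rightarrow> bool" where
  "principal_on I U \<longleftrightarrow> (\<exists>x\<in>I. U = {A. A \<subseteq> I \<and> x \<in> A})"

definition filter_base_for :: "'a set set \<Rightarrow> 'a set set \<Rightarrow> bool" where
  "filter_base_for \<B> U \<longleftrightarrow> \<B> \<subseteq> U \<and> (\<forall>A\<in>U. \<exists>B\<in>\<B>. B \<subseteq> A)"

definition FIN :: "nat set set" where
  "FIN = {s. finite s \<and> s \<noteq> {}}"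

definition block_seqs :: "(nat \<Rightarrow> nat set) set" where
  "block_seqs = {X. (\<forall>i. X i \<in> FIN) \<and> (\<forall>i. Max (X i) < Min (X (Suc i)))}"

definition finite_unions :: "(nat \<Rightarrow> nat set) \<Rightarrow> nat set set" where
  "finite_unions X = {\<Union>i\<in>F. X i |F. finite F \<and> F \<noteq> {}}"

definition block_le :: "(nat \<Rightarrow> nat set) \<Rightarrow> (nat \<Rightarrow> nat set) \<Rightarrow> bool" where
  "block_le X Y \<longleftrightarrow> (\<forall>i. X i \<in> finite_unions Y)"

text \<open>The tail \<open>X / n\<close>. For a block sequence the minima \<open>Min (X i)\<close> are strictly increasing in
  \<open>i\<close>, so the least index always exists.\<close>

definition block_tail :: "(nat \<Rightarrow> nat set) \<Rightarrow> nat \<Rightarrow> nat \<Rightarrow> nat set" where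
  "block_tail X n = (\<lambda>i. X ((LEAST j. n < Min (X j)) + i))"

definition block_le_star :: "(nat \<Rightarrow> nat set) \<Rightarrow> (nat \<Rightarrow> nat set) \<Rightarrow> bool" where
  "block_le_star X Y \<longleftrightarrow> (\<exists>n. block_le (block_tail X n) Y)"

definition ordered_union :: "nat set set set \<Rightarrow> bool" where
  "ordered_union U \<longleftrightarrow> ultrafilter_on FIN U \<and>
     (\<exists>\<B>. filter_base_for \<B> U \<and> (\<forall>B\<in>\<B>. \<exists>X\<in>block_seqs. B = finite_unions X))"

definition stable_ordered_union :: "nat set set set \<Rightarrow> bool" where
  "stable_ordered_union U \<longleftrightarrow> ordered_union U \<and>
     (\<forall>S :: nat \<Rightarrow> nat \<Rightarrow> nat set.
        (\<forall>i. S i \<in> block_seqs \<and> finite_unions (S i) \<in> U \<and> block_le_star (S (Suc i)) (S i)) \<longrightarrow>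
        (\<exists>X\<in>block_seqs. finite_unions X \<in> U \<and> (\<forall>i. block_le_star X (S i))))"

text \<open>Of the two conditions that Miller showed to be equivalent, this is the one with the explicit
  bound \<open>n\<close>; the one with an arbitrary bound \<open>h n\<close> follows from it with \<open>h = id\<close>.\<close>

definition rapid_on :: "'a set \<Rightarrow> 'a set set \<Rightarrow> bool" where
  "rapid_on I V \<longleftrightarrow> countable I \<and> ultrafilter_on I V \<and> \<not> principal_on I V \<and>
     (\<forall>P :: nat \<Rightarrow> 'a set. (\<forall>n. finite (P n) \<and> P n \<subseteq> I) \<longrightarrow>
        (\<exists>X\<in>V. \<forall>n. card (X \<inter> P n) \<le> n))"

end

theory Submission
  imports Defs
begin

text \<open>
  An ordered-union ultrafilter contains sets \<open>[X]\<close> whose blocks go to infinity as fast as one likes,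
  and this already makes it rapid.

  To force fast growth, cut \<open>\<omega>\<close> into consecutive finite intervals, the fibres of a slowly growing
  monotone map \<open>q\<close>, and colour \<open>s \<in> FIN\<close> by the parity of the number \<open>card (q ` s)\<close> of intervals that
  \<open>s\<close> meets. If \<open>x\<close> lies below \<open>y\<close>, these numbers add up for \<open>x \<union> y\<close>, except that the sum drops by
  one when \<open>Max x\<close> and \<open>Min y\<close> share an interval. On a homogeneous \<open>[X]\<close> the colour cannot
  be odd, since two far apart members of \<open>[X]\<close> would have a union of even colour. So it is even, and
  then no two consecutive blocks can share an interval: their union would be odd. Hence every
  block moves on to a new interval, and long intervals make the maxima of the blocks grow quickly
  (\<open>even_hits_meets_finite_unions\<close>, \<open>even_hits_separates_blocks\<close>, \<open>ordered_union_fast_growth\<close>).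

  For rapidity, let the \<open>k\<close>-th block reach beyond all members of \<open>P n\<close> with \<open>n < 2 ^ (k + 1)\<close>.
  If \<open>2 ^ K \<le> n + 1 < 2 ^ (K + 1)\<close>, a member of \<open>[X] \<inter> P n\<close> uses only the first \<open>K\<close> blocks, and
  these have only \<open>2 ^ K - 1 \<le> n\<close> nonempty unions.
\<close>

section \<open>Block sequences and their finite unions\<close>

lemma block_seq_FIN: "X \<in> block_seqs \<Longrightarrow> X i \<in> FIN"
  by (simp add: block_seqs_def)

lemma FIN_Max_mem: "s \<in> FIN \<Longrightarrow> Max s \<in> s" and FIN_Min_mem: "s \<in> FIN \<Longrightarrow> Min s \<in> s"
  by (simp_all add: FIN_def)

lemma FIN_Min_le: "s \<in> FIN \<Longrightarrow> a \<in> s \<Longrightarrow> Min s \<le> a"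
  and FIN_le_Max: "s \<in> FIN \<Longrightarrow> a \<in> s \<Longrightarrow> a \<le> Max s"
  by (simp_all add: FIN_def)

lemma FIN_Min_le_Max: "s \<in> FIN \<Longrightarrow> Min s \<le> Max s"
  by (simp add: FIN_Min_mem FIN_le_Max)

lemma block_seq_Max_less_Min:
  assumes X: "X \<in> block_seqs" and "i < j"
  shows "Max (X i) < Min (X j)"
  using \<open>i < j\<close>
proof (induction rule: less_Suc_induct)
  case (1 i)
  then show ?case using X by (simp add: block_seqs_def)
next
  case (2 i j k)
  then show ?case using FIN_Min_le_Max[OF block_seq_FIN[OF X, of j]] by linarith
qed

lemma block_seq_index_le_Min:
  assumes X: "X \<in> block_seqs"
  shows "i \<le> Min (X i)"
proof (induction i)
  case (Suc i)
  then show ?case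
    using FIN_Min_le_Max[OF block_seq_FIN[OF X, of i]] block_seq_Max_less_Min[OF X, of i "Suc i"]
    by simp
qed simp

lemma block_seq_Max_mono:
  assumes X: "X \<in> block_seqs" and "i \<le> j"
  shows "Max (X i) \<le> Max (X j)"
  using block_seq_Max_less_Min[OF X, of i j] FIN_Min_le_Max[OF block_seq_FIN[OF X, of j]] \<open>i \<le> j\<close>
  by (cases "i = j") auto

lemma block_mem_finite_unions: "X i \<in> finite_unions X"
  unfolding finite_unions_def by (intro CollectI exI[of _ "{i}"]) simp

lemma block_Un_mem_finite_unions: "X i \<union> X j \<in> finite_unions X"
  unfolding finite_unions_def by (intro CollectI exI[of _ "{i, j}"]) simp

section \<open>Ordered-union ultrafilters\<close>

lemma ordered_union_ultrafilter: "ordered_union U \<Longrightarrow> ultrafilter_on FIN U"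
  by (simp add: ordered_union_def)

lemma ordered_union_basis:
  assumes "ordered_union U" and "A \<in> U"
  obtains X where "X \<in> block_seqs" "finite_unions X \<in> U" "finite_unions X \<subseteq> A"
  using assms unfolding ordered_union_def filter_base_for_def by (metis subsetD)

text \<open>If \<open>A\<close> were not in \<open>U\<close>, its complement would be, and would contain some \<open>[X]\<close>.\<close>

lemma ordered_union_memI:
  assumes U: "ordered_union U" and A: "A \<subseteq> FIN"
    and meets: "\<And>X. X \<in> block_seqs \<Longrightarrow> finite_unions X \<inter> A \<noteq> {}"
  shows "A \<in> U"
proof (rule ccontr)
  assume "A \<notin> U"
  then have "FIN - A \<in> U"
    using ordered_union_ultrafilter[OF U] A unfolding ultrafilter_on_def by blast
  then obtain X where "X \<in> block_seqs" "finite_unions X \<subseteq> FIN - A"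
    by (rule ordered_union_basis[OF U])
  with meets show False by blast
qed

lemma ordered_union_nonprincipal:
  assumes U: "ordered_union U"
  shows "\<not> principal_on FIN U"
proof
  assume "principal_on FIN U"
  then obtain s where s: "U = {A. A \<subseteq> FIN \<and> s \<in> A}"
    by (auto simp: principal_on_def)
  have "FIN - {s} \<in> U"
  proof (rule ordered_union_memI[OF U])
    fix X assume X: "X \<in> block_seqs"
    have "X 0 \<noteq> X 1"
      using block_seq_Max_less_Min[OF X, of 0 1] FIN_Min_le_Max[OF block_seq_FIN[OF X, of 0]] by auto
    then show "finite_unions X \<inter> (FIN - {s}) \<noteq> {}"
      using block_mem_finite_unions[of X] block_seq_FIN[OF X] by (metis DiffI IntI empty_iff singletonD)
  qed auto
  with s show False by simp
qed

section \<open>Counting the intervals met by a finite set\<close>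

text \<open>A sufficiently late block meets none of the intervals that \<open>X 0\<close> meets. If both blocks meet an
  odd number of intervals, their union therefore meets an even number.\<close>

lemma even_hits_meets_finite_unions:
  fixes q :: "nat \<Rightarrow> nat"
  assumes q: "mono q" and unbounded: "\<And>k. \<exists>m. k < q m"
    and X: "X \<in> block_seqs"
  shows "\<exists>s \<in> finite_unions X. even (card (q ` s))"
proof -
  obtain m where m: "q (Max (X 0)) < q m"
    using unbounded by blast
  have fin: "finite (q ` X 0)" "finite (q ` X m)"
    using block_seq_FIN[OF X] by (auto simp: FIN_def)
  have "q a < q b" if "a \<in> X 0" "b \<in> X m" for a b
  proof -
    have "q a \<le> q (Max (X 0))"
      using FIN_le_Max[OF block_seq_FIN[OF X] that(1)] q by (simp add: monoD)
    moreover have "m \<le> b"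
      using block_seq_index_le_Min[OF X, of m] FIN_Min_le[OF block_seq_FIN[OF X] that(2)]
      by simp
    then have "q m \<le> q b"
      using q by (simp add: monoD)
    ultimately show ?thesis using m by linarith
  qed
  then have "q ` X 0 \<inter> q ` X m = {}"
    by fastforce
  then have "card (q ` (X 0 \<union> X m)) = card (q ` X 0) + card (q ` X m)"
    using fin by (simp add: image_Un card_Un_disjoint)
  then have "even (card (q ` X 0)) \<or> even (card (q ` X m)) \<or> even (card (q ` (X 0 \<union> X m)))"
    by presburger
  then show ?thesis
    using block_mem_finite_unions[of X] block_Un_mem_finite_unions[of X] by blast
qed

text \<open>If two consecutive blocks shared an interval, it would be their only common one, so that their
  union would meet an odd number of intervals.\<close>

lemma even_hits_separates_blocks:
  fixes q :: "nat \<Rightarrow> nat"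
  assumes q: "mono q" and X: "X \<in> block_seqs"
    and even: "\<And>s. s \<in> finite_unions X \<Longrightarrow> even (card (q ` s))"
  shows "q (Max (X i)) < q (Min (X (Suc i)))"
proof (rule ccontr)
  let ?x = "X i" and ?y = "X (Suc i)"
  have le: "q (Max ?x) \<le> q (Min ?y)"
    using block_seq_Max_less_Min[OF X, of i "Suc i"] q by (simp add: monoD)
  assume "\<not> q (Max ?x) < q (Min ?y)"
  with le have eq: "q (Max ?x) = q (Min ?y)" by simp
  have fin: "finite (q ` ?x)" "finite (q ` ?y)"
    using block_seq_FIN[OF X] by (auto simp: FIN_def)
  have "q ` ?x \<inter> q ` ?y = {q (Max ?x)}"
  proof
    have "q (Max ?x) \<in> q ` ?x" "q (Min ?y) \<in> q ` ?y"
      using FIN_Max_mem FIN_Min_mem block_seq_FIN[OF X] by blast+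
    with eq show "{q (Max ?x)} \<subseteq> q ` ?x \<inter> q ` ?y" by simp
    have "q a = q (Max ?x)" if "a \<in> ?x" "b \<in> ?y" "q a = q b" for a b
    proof (rule antisym)
      show "q a \<le> q (Max ?x)"
        using FIN_le_Max[OF block_seq_FIN[OF X] that(1)] q by (simp add: monoD)
      show "q (Max ?x) \<le> q a"
        using FIN_Min_le[OF block_seq_FIN[OF X] that(2)] q eq that(3) by (simp add: monoD)
    qed
    then show "q ` ?x \<inter> q ` ?y \<subseteq> {q (Max ?x)}" by auto
  qed
  then have "card (q ` ?x) + card (q ` ?y) = card (q ` (?x \<union> ?y)) + 1"
    using card_Un_Int[OF fin] by (simp add: image_Un)
  moreover have "even (card (q ` ?x))" "even (card (q ` ?y))" "even (card (q ` (?x \<union> ?y)))"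
    using even block_mem_finite_unions[of X] block_Un_mem_finite_unions[of X] by blast+
  ultimately show False by (metis even_add odd_one)
qed

text \<open>A slow inverse of \<open>G\<close>: to reach an interval after the \<open>k\<close>-th one, a number must be at least
  \<open>G k\<close>. The index of \<open>m\<close> is the number of values up to \<open>m\<close> of a strictly increasing function
  above \<open>G\<close>.\<close>

lemma slow_interval_index:
  fixes G :: "nat \<Rightarrow> nat"
  obtains q :: "nat \<Rightarrow> nat" where "mono q" "\<And>k. \<exists>m. k < q m" "\<And>k m. k < q m \<Longrightarrow> G k \<le> m"
proof
  define H where "H k = k + (\<Sum>j\<le>k. G j)" for k
  have H_mono: "H i \<le> H j" if "i \<le> j" for i j
    using that unfolding H_def by (intro add_mono sum_mono2) auto
  have G_le: "G k \<le> H k" for k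
    unfolding H_def by (intro trans_le_add2 member_le_sum) auto
  define q where "q m = card {k. H k \<le> m}" for m
  have fin: "finite {k. H k \<le> m}" for m
    by (rule finite_subset[of _ "{..m}"]) (auto simp: H_def)
  show "mono q"
    unfolding q_def by (intro monoI card_mono fin) auto
  show "\<exists>m. k < q m" for k
  proof
    have "card {..k} \<le> q (H k)"
      unfolding q_def by (intro card_mono fin) (auto simp: H_mono)
    then show "k < q (H k)" by simp
  qed
  show "G k \<le> m" if "k < q m" for k m
  proof -
    have "\<not> {j. H j \<le> m} \<subseteq> {..<k}"
    proof
      assume "{j. H j \<le> m} \<subseteq> {..<k}"
      then have "q m \<le> k" using card_mono[of "{..<k}" "{j. H j \<le> m}"] by (simp add: q_def)
      with that show False by simp
    qed
    then obtain j where "H j \<le> m" "k \<le> j"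
      unfolding subset_iff lessThan_iff mem_Collect_eq not_all not_imp not_less by blast
    with H_mono[of k j] G_le[of k] show ?thesis by linarith
  qed
qed

section \<open>Fast growing blocks and rapidity\<close>

lemma ordered_union_fast_growth:
  fixes G :: "nat \<Rightarrow> nat"
  assumes U: "ordered_union U"
  obtains X where "X \<in> block_seqs" "finite_unions X \<in> U" "\<And>k. G k \<le> Max (X k)"
proof -
  obtain q :: "nat \<Rightarrow> nat" where q: "mono q" and unbounded: "\<And>k. \<exists>m. k < q m"
    and G: "\<And>k m. k < q m \<Longrightarrow> G k \<le> m"
    by (rule slow_interval_index[of G]) blast
  define E where "E = {s \<in> FIN. even (card (q ` s))}"
  \<comment> \<open>Leaving the zeroth interval at once gives the strict bound \<open>k < q (Max (X k))\<close> below.\<close>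
  define L where "L = {s \<in> FIN. 0 < q (Max s)}"
  have unions_FIN: "finite_unions X \<subseteq> FIN" if "X \<in> block_seqs" for X
    using block_seq_FIN[OF that] by (fastforce simp: finite_unions_def FIN_def)
  have "E \<in> U"
    using even_hits_meets_finite_unions[OF q unbounded] unions_FIN
    by (intro ordered_union_memI[OF U]) (fastforce simp: E_def)+
  moreover have "L \<in> U"
  proof (rule ordered_union_memI[OF U])
    fix X assume X: "X \<in> block_seqs"
    obtain m where "0 < q m" using unbounded by blast
    moreover have "m \<le> Max (X m)"
      using block_seq_index_le_Min[OF X, of m] FIN_Min_le_Max[OF block_seq_FIN[OF X, of m]] by simp
    then have "q m \<le> q (Max (X m))" using q by (simp add: monoD)
    ultimately have "X m \<in> L" using block_seq_FIN[OF X] by (simp add: L_def)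
    then show "finite_unions X \<inter> L \<noteq> {}" using block_mem_finite_unions[of X m] by blast
  qed (auto simp: L_def)
  ultimately have "E \<inter> L \<in> U"
    using ordered_union_ultrafilter[OF U] unfolding ultrafilter_on_def by blast
  then obtain X where X: "X \<in> block_seqs" "finite_unions X \<in> U" "finite_unions X \<subseteq> E \<inter> L"
    by (rule ordered_union_basis[OF U])
  have "k < q (Max (X k))" for k
  proof (induction k)
    case 0
    show ?case using X(3) block_mem_finite_unions[of X 0] by (auto simp: L_def)
  next
    case (Suc k)
    have "q (Max (X k)) < q (Min (X (Suc k)))"
      using X(3) by (intro even_hits_separates_blocks[OF q X(1)]) (auto simp: E_def)
    also have "\<dots> \<le> q (Max (X (Suc k)))"
      using q FIN_Min_le_Max[OF block_seq_FIN[OF X(1)]] by (simp add: monoD)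
    finally show ?case using Suc by simp
  qed
  with X G show thesis by (intro that[of X]) auto
qed

text \<open>A union that uses a block of index at least \<open>K\<close> has maximum at least \<open>Max (X K)\<close>, so every
  member of \<open>B\<close> is a nonempty union of the first \<open>K\<close> blocks.\<close>

lemma card_finite_unions_below_block:
  assumes X: "X \<in> block_seqs"
    and B: "B \<subseteq> finite_unions X" "\<And>s. s \<in> B \<Longrightarrow> Max s < Max (X K)"
  shows "card B \<le> 2 ^ K - 1"
proof -
  have "B \<subseteq> (\<lambda>F. \<Union>i\<in>F. X i) ` (Pow {..<K} - {{}})"
  proof
    fix s assume s: "s \<in> B"
    with B(1) obtain F where F: "finite F" "F \<noteq> {}" "s = (\<Union>i\<in>F. X i)"
      by (auto simp: finite_unions_def)
    have "i < K" if i: "i \<in> F" for i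
    proof (rule ccontr)
      assume "\<not> i < K"
      then have "Max (X K) \<le> Max (X i)" by (simp add: block_seq_Max_mono[OF X])
      also have "Max (X i) \<le> Max s"
      proof (rule Max_ge)
        show "finite s" using F block_seq_FIN[OF X] by (auto simp: FIN_def)
        show "Max (X i) \<in> s" using i F(3) FIN_Max_mem[OF block_seq_FIN[OF X]] by blast
      qed
      finally show False using B(2)[OF s] by simp
    qed
    with F show "s \<in> (\<lambda>F. \<Union>i\<in>F. X i) ` (Pow {..<K} - {{}})" by auto
  qed
  then have "card B \<le> card (Pow {..<K} - {{}})"
    by (rule surj_card_le[rotated]) simp
  also have "\<dots> = 2 ^ K - 1" by (simp add: card_Diff_singleton card_Pow)
  finally show ?thesis .
qed

theorem theorem3p3:
  fixes U :: "nat set set set"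
  assumes "stable_ordered_union U"
  shows "rapid_on FIN U"
proof -
  have U: "ordered_union U"
    using assms by (simp add: stable_ordered_union_def)
  have "countable FIN"
    by (rule countable_subset[OF _ countable_Collect_finite]) (auto simp: FIN_def)
  moreover have "\<exists>A\<in>U. \<forall>n. card (A \<inter> P n) \<le> n" if P: "\<forall>n. finite (P n) \<and> P n \<subseteq> FIN" for P
  proof -
    define G where "G k = Suc (Max (insert 0 (Max ` (\<Union>n<2 ^ Suc k. P n))))" for k :: nat
    have G: "Max s < G k" if "s \<in> P n" "n < 2 ^ Suc k" for s n k
      unfolding G_def less_Suc_eq_le using that P by (intro Max_ge) auto
    obtain X where X: "X \<in> block_seqs" "finite_unions X \<in> U" "\<And>k. G k \<le> Max (X k)"
      by (rule ordered_union_fast_growth[OF U, of G]) blast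
    have "card (finite_unions X \<inter> P n) \<le> n" for n
    proof -
      obtain K where K: "2 ^ K \<le> Suc n" "Suc n < 2 ^ Suc K"
        using ex_power_ivl1[of 2 "Suc n"] by auto
      have "card (finite_unions X \<inter> P n) \<le> 2 ^ K - 1"
      proof (rule card_finite_unions_below_block[OF X(1)])
        show "Max s < Max (X K)" if "s \<in> finite_unions X \<inter> P n" for s
          using G[of s n K] K(2) X(3)[of K] that by simp
      qed simp
      with K(1) show ?thesis by linarith
    qed
    with X(2) show ?thesis by blast
  qed
  ultimately show ?thesis
    using ordered_union_ultrafilter[OF U] ordered_union_nonprincipal[OF U]
    unfolding rapid_on_def by blast
qed

end
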